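(* For all integers $n\ge0$, $$\xi_{-1}(5n+3)\equiv 3\,\xi_{-1}(5n+2)\equiv 2\,\xi_{-1}(5n+1)\pmod5 .$$
   Context: The numbers $\xi_{-1}(n)\in\mathbb{Z}$ ($n\ge 0$) are defined by the formal power series identity $$\sum_{n=0}^\infty \xi_{-1}(n)q^n=F((1-q)^{-1})=\sum_{n=0}^\infty\prod_{i=1}^n\left(1-(1-q)^{-i}\right),\qquad F(q)=\sum_{n=0}^\infty\prod_{i=1}^n(1-q^i),$$ where $(1-q)^{-i}$ is expanded as a formal power series in $q$; the sum is well defined in $\mathbb{Z}[[q]]$ because the $n$-th summand of $F((1-q)^{-1})$ is divisible by $q^n$. *)

theory Defs
  imports
    "HOL-Computational_Algebra.Formal_Power_Series"
    "HOL-Number_Theory.Cong"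
begin

text \<open>The infinite sum is taken with respect to the library's metric on formal power series,
  i.e. coefficientwise stabilisation. It converges whenever \<open>u\<close> has constant term \<open>1\<close>,
  as shown below; for other \<open>u\<close> the value may be meaningless.\<close>

definition kontsevich_F :: "int fps \<Rightarrow> int fps" where
  "kontsevich_F u = (\<Sum>n. \<Prod>i=1..n. (1 - u ^ i))"

text \<open>Division-based inverses of power series are not available over the integers, so
  \<open>(1 - q)\<^sup>-\<^sup>1\<close> is the recursively constructed inverse with constant term \<open>1\<close>.\<close>

definition inv_1_minus_q :: "int fps" where
  "inv_1_minus_q = fps_left_inverse (1 - fps_X) 1"

definition xi_minus_1 :: "nat \<Rightarrow> int" where
  "xi_minus_1 n = fps_nth (kontsevich_F inv_1_minus_q) n"

lemma inv_1_minus_q: "inv_1_minus_q * (1 - fps_X) = 1"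
  unfolding inv_1_minus_q_def by (rule fps_left_inverse) simp

lemma inv_1_minus_q_nth_0: "fps_nth inv_1_minus_q 0 = 1"
  by (simp add: inv_1_minus_q_def)

lemma fps_X_power_dvd_summand:
  fixes u :: "int fps"
  assumes "fps_nth u 0 = 1"
  shows "fps_X ^ n dvd (\<Prod>i=1..n. (1 - u ^ i))"
proof -
  have "fps_X dvd 1 - u ^ i" for i
  proof -
    have "fps_nth (1 - u ^ i) 0 = 0"
      by (simp add: assms fps_power_zeroth)
    then have "1 - u ^ i = fps_X * fps_shift 1 (1 - u ^ i)"
      by (intro fps_ext) (auto simp: fps_X_mult_nth)
    then show ?thesis by (rule dvdI)
  qed
  then have "(\<Prod>i=1..n. fps_X) dvd (\<Prod>i=1..n. (1 - u ^ i))"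
    by (intro prod_dvd_prod) auto
  then show ?thesis by simp
qed

lemma summand_nth_eq_0:
  fixes u :: "int fps"
  assumes "fps_nth u 0 = 1" "m < n"
  shows "fps_nth (\<Prod>i=1..n. (1 - u ^ i)) m = 0"
proof -
  obtain h where h: "(\<Prod>i=1..n. (1 - u ^ i)) = fps_X ^ n * h"
    using fps_X_power_dvd_summand[OF assms(1), of n] by (elim dvdE)
  show ?thesis
    unfolding h using assms(2) by (simp add: fps_X_power_mult_nth)
qed

lemma kontsevich_F_sums:
  assumes "fps_nth u 0 = 1"
  shows "(\<lambda>n. \<Prod>i=1..n. (1 - u ^ i)) sums kontsevich_F u"
proof -
  let ?t = "\<lambda>n. \<Prod>i=1..n. (1 - u ^ i)"
  have "?t sums Abs_fps (\<lambda>m. fps_nth (\<Sum>n\<le>m. ?t n) m)"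
    unfolding sums_def
  proof (rule tendsto_fpsI)
    fix m
    have "fps_nth (\<Sum>n<N. ?t n) m = fps_nth (\<Sum>n\<le>m. ?t n) m" if "m < N" for N
    proof -
      have "(\<Sum>n\<le>m. fps_nth (?t n) m) = (\<Sum>n<N. fps_nth (?t n) m)"
      proof (rule sum.mono_neutral_left)
        show "\<forall>n\<in>{..<N} - {..m}. fps_nth (?t n) m = 0"
          using summand_nth_eq_0[OF assms, of m] by (meson DiffE atMost_iff not_le)
      qed (use that in auto)
      then show ?thesis by (simp add: fps_sum_nth)
    qed
    then show "\<forall>\<^sub>F N in sequentially. fps_nth (\<Sum>n<N. ?t n) m =
        fps_nth (Abs_fps (\<lambda>m. fps_nth (\<Sum>n\<le>m. ?t n) m)) m"
      unfolding eventually_sequentially by (intro exI[of _ "Suc m"]) simp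
  qed
  then show ?thesis
    unfolding kontsevich_F_def using sums_summable summable_sums by blast
qed

end

theory Submission
  imports Defs "HOL-Computational_Algebra.Polynomial"
begin

text \<open>
  Write \<open>u = 1 / (1 - X)\<close>. For \<open>N = 5\<^sup>k\<close> one has \<open>u\<^sup>N = 1\<close> modulo 5 and \<open>X\<^sup>N\<close>, so to any given
  precision \<open>u\<close> may be treated as an \<open>N\<close>-th root of unity. At such a point Kontsevich's function
  breaks off after \<open>N\<close> terms, and there it equals a finite, regularised form of the divergent series
  in Zagier's strange identity,
  \<open>4 F(u) = \<Sum> \<plusminus> m u\<^bsup>(m\<^sup>2 - 1)/24\<^esup>\<close>, summed over the \<open>m < 6N\<close> that are \<open>\<plusminus>1\<close> modulo 6.

  Modulo 5 the exponents \<open>(m\<^sup>2 - 1) / 24\<close> take the residues 0, 1, 2, and the residue 1 occurs exactly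
  when 5 divides the coefficient \<open>m\<close>. So \<open>F(u)\<close> is modulo 5 a linear combination of powers
  \<open>u\<^sup>e\<close> with \<open>e\<close> congruent to 0 or 2. Because \<open>u\<^sup>5 = 1 / (1 - X\<^sup>5)\<close> modulo 5, the coefficients
  of these powers in a block of five consecutive positions are proportional to those of \<open>1\<close> or of
  \<open>u\<^sup>2 = \<Sum> (n + 1) X\<^sup>n\<close>, that is to \<open>1, 0, 0, 0, 0\<close> or \<open>1, 2, 3, 4, 0\<close>. Both satisfy the asserted
  relations between positions 1, 2 and 3 (lemma \<open>rel5_pentagonal_term\<close>).

  The finite identity is lemma \<open>strange_identity_dvd\<close>. Introduce a second variable \<open>x\<close> and the
  polynomial \<open>p(x) = (1 - x) \<Sum>\<^bsub>r<N\<^esub> (xq;q)\<^sub>r x\<^sup>r\<close>, whose derivative at 1 is \<open>- F\<^sub>N(q)\<close>. It satisfies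
  a functional equation connecting \<open>p(x)\<close> and \<open>p(qx)\<close> (\<open>zagier_sum_functional_equation\<close>). Where
  \<open>q\<^sup>N = 1\<close>, iterating this equation \<open>N\<close> times leads back to \<open>p(x)\<close>, which evaluates \<open>p\<close> in closed
  form (\<open>zagier_identity_dvd\<close>); comparing derivatives at \<open>x = 1\<close> yields the identity. All of this is
  algebra over an arbitrary integral domain, and the condition \<open>q\<^sup>N = 1\<close> is expressed by divisibility by
  \<open>q\<^sup>N - 1\<close>, because it holds for \<open>u\<close> only approximately.
\<close>

section \<open>A functional equation for truncated q-series\<close>

text \<open>In the usual notation this is \<open>(xq; q)\<^sub>n\<close>, without the factor \<open>1 - x\<close> of \<open>(x; q)\<^bsub>n+1\<^esub>\<close>.\<close>

definition qpoch :: "'a::comm_ring_1 \<Rightarrow> 'a \<Rightarrow> nat \<Rightarrow> 'a" where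
  "qpoch q x n = (\<Prod>i=1..n. (1 - x * q ^ i))"

text \<open>At \<open>x = 1\<close> the prefactor vanishes and the remaining sum is the truncation \<open>F\<^sub>N(q)\<close>, so that
\<open>F\<^sub>N(q)\<close> is minus the derivative there. Because of the prefactor, the coefficients of the
functional equation below are monomials, so that its iterates have a closed form.\<close>

definition zagier_sum :: "nat \<Rightarrow> 'a::comm_ring_1 \<Rightarrow> 'a \<Rightarrow> 'a" where
  "zagier_sum N q x = (1 - x) * (\<Sum>r<N. qpoch q x r * x ^ r)"

definition pentagonal :: "nat \<Rightarrow> nat" where
  "pentagonal j = j * (3 * j + 1) div 2"

text \<open>The general term contributes the two monomials with exponents \<open>(m\<^sup>2 - 1) / 24\<close> in \<open>q\<close> and
\<open>(m - 1) / 2\<close> in \<open>x\<close>, for \<open>m = 6j + 1\<close> and \<open>m = 6j + 5\<close>. As \<open>n\<close> grows this is a partial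
theta function; it turns into a partial sum of Euler's pentagonal series when \<open>x = 1\<close>.\<close>

definition pentagonal_sum :: "nat \<Rightarrow> 'a::comm_ring_1 \<Rightarrow> 'a \<Rightarrow> 'a" where
  "pentagonal_sum n q x = (\<Sum>j<n. (- 1) ^ j * q ^ pentagonal j * x ^ (3 * j) * (1 - q ^ (2 * j + 1) * x ^ 2))"

lemma qpoch_0 [simp]: "qpoch q x 0 = 1"
  by (simp add: qpoch_def)

lemma qpoch_Suc: "qpoch q x (Suc n) = qpoch q x n * (1 - x * q ^ Suc n)"
  by (simp add: qpoch_def)

lemma qpoch_shift: "(1 - q * x) * qpoch q (q * x) n = qpoch q x (Suc n)"
proof (induction n)
  case (Suc n)
  have "(1 - q * x) * qpoch q (q * x) (Suc n)
      = ((1 - q * x) * qpoch q (q * x) n) * (1 - x * q ^ Suc (Suc n))"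
    by (simp add: qpoch_Suc ac_simps)
  then show ?case
    by (simp only: Suc qpoch_Suc[of q x "Suc n"])
qed (simp add: qpoch_Suc mult.commute)

lemma pentagonal_0 [simp]: "pentagonal 0 = 0"
  by (simp add: pentagonal_def)

lemma pentagonal_Suc: "pentagonal (Suc j) = pentagonal j + 3 * j + 2"
proof -
  have "Suc j * (3 * Suc j + 1) = j * (3 * j + 1) + 2 * (3 * j + 2)"
    by (simp add: algebra_simps)
  then show ?thesis
    unfolding pentagonal_def by (simp only:) simp
qed

text \<open>Since \<open>q\<^bsup>r+1\<^esup> x (xq;q)\<^sub>r = (xq;q)\<^sub>r - (xq;q)\<^bsub>r+1\<^esub>\<close>, the sum at \<open>qx\<close> is a difference of two index
shifts of the sum at \<open>x\<close>. The last term below is the price of truncating: it is absent for the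
infinite series, and it carries the factor \<open>1 - q\<^sup>N\<close> when \<open>x = 1\<close>.\<close>

lemma zagier_sum_functional_equation:
  "zagier_sum N q x + q ^ 2 * x ^ 3 * zagier_sum N q (q * x)
    = (1 - q * x ^ 2) - x ^ N * qpoch q x N * (1 - q ^ (N + 1) * x ^ 2)"
proof (induction N)
  case 0
  show ?case by (simp add: zagier_sum_def)
next
  case (Suc N)
  define A where "A = qpoch q x N"
  define B where "B = qpoch q (q * x) N"
  define a where "a = q ^ Suc N"
  have shift: "(1 - q * x) * B = A * (1 - x * a)"
    unfolding A_def B_def a_def using qpoch_shift[of q x N] by (simp add: qpoch_Suc)
  have step: "zagier_sum (Suc N) q y = zagier_sum N q y + (1 - y) * (qpoch q y N * y ^ N)" for y
    by (simp add: zagier_sum_def algebra_simps)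
  have "q ^ 2 * x ^ 3 * ((1 - q * x) * (B * (q * x) ^ N))
      = q * x ^ 3 * x ^ N * a * ((1 - q * x) * B)"
    by (simp add: a_def power_mult_distrib power2_eq_square algebra_simps)
  also have "\<dots> = q * x ^ 3 * x ^ N * a * (A * (1 - x * a))"
    by (simp only: shift)
  finally have new: "q ^ 2 * x ^ 3 * ((1 - q * x) * (B * (q * x) ^ N))
      = q * x ^ 3 * x ^ N * a * (A * (1 - x * a))" .
  have "zagier_sum (Suc N) q x + q ^ 2 * x ^ 3 * zagier_sum (Suc N) q (q * x)
      = (zagier_sum N q x + q ^ 2 * x ^ 3 * zagier_sum N q (q * x))
        + (1 - x) * (A * x ^ N) + q ^ 2 * x ^ 3 * ((1 - q * x) * (B * (q * x) ^ N))"
    unfolding step A_def B_def by (simp add: distrib_left)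
  also have "\<dots> = (1 - q * x ^ 2) - x ^ N * A * (1 - a * x ^ 2)
        + (1 - x) * (A * x ^ N) + q * x ^ 3 * x ^ N * a * (A * (1 - x * a))"
    unfolding Suc.IH new by (simp add: A_def a_def)
  also have "\<dots> = (1 - q * x ^ 2) - x * x ^ N * (A * (1 - x * a)) * (1 - q * a * x ^ 2)"
    by (simp add: algebra_simps power2_eq_square power3_eq_cube)
  finally show ?case
    by (simp add: A_def a_def qpoch_Suc)
qed

lemma zagier_sum_cong_dvd:
  assumes "d dvd y - x"
  shows "d dvd zagier_sum N q y - zagier_sum N q x"
proof -
  have diff_mult: "d dvd a * b - a' * b'" if "d dvd a - a'" "d dvd b - b'" for a b a' b' :: 'a
  proof -
    have "a * b - a' * b' = (a - a') * b + a' * (b - b')" by (simp add: algebra_simps)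
    then show ?thesis using that by simp
  qed
  have pow: "d dvd y ^ r - x ^ r" for r
    by (induction r) (auto intro!: diff_mult assms)
  have fac: "d dvd (1 - y * c) - (1 - x * c)" for c
  proof -
    have "(1 - y * c) - (1 - x * c) = (y - x) * (- c)" by (simp add: algebra_simps)
    then show ?thesis using assms by (metis dvd_mult2)
  qed
  have prd: "d dvd qpoch q y r - qpoch q x r" for r
  proof (induction r)
    case (Suc r)
    show ?case unfolding qpoch_Suc by (intro diff_mult Suc fac)
  qed simp
  have "d dvd (\<Sum>r<N. qpoch q y r * y ^ r) - (\<Sum>r<N. qpoch q x r * x ^ r)"
    unfolding sum_subtractf[symmetric] by (intro dvd_sum diff_mult prd pow)
  then show ?thesis
    unfolding zagier_sum_def using fac[of 1] by (intro diff_mult) auto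
qed

text \<open>Once \<open>q\<^sup>N = 1\<close>, the product \<open>(xq;q)\<^sub>N\<close> runs over a full cycle of powers of \<open>q\<close>, so replacing
\<open>x\<close> by \<open>qx\<close> only permutes its factors.\<close>

lemma tail_invariant_dvd:
  "q ^ N - 1 dvd (q ^ j * x) ^ N * qpoch q (q ^ j * x) N - x ^ N * qpoch q x N"
proof (induction j)
  case 0
  show ?case by simp
next
  case (Suc j)
  define y where "y = q ^ j * x"
  have "(q * y) ^ N * qpoch q (q * y) N - y ^ N * qpoch q y N
     = (q ^ N - 1) * (y ^ N * qpoch q (q * y) N)
       + y ^ N * (qpoch q (q * y) N - qpoch q y N)"
    by (simp add: algebra_simps power_mult_distrib)
  moreover have "q ^ N - 1 dvd qpoch q (q * y) N - qpoch q y N"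
  proof (cases N)
    case (Suc M)
    have "qpoch q (q * y) N - qpoch q y N
        = qpoch q (q * y) M * (1 - q * y * q ^ N) - (1 - q * y) * qpoch q (q * y) M"
      unfolding Suc by (simp only: qpoch_Suc qpoch_shift)
    also have "\<dots> = (q ^ N - 1) * (- q * y * qpoch q (q * y) M)"
      by (simp add: algebra_simps)
    finally show ?thesis by simp
  qed simp
  ultimately have "q ^ N - 1 dvd (q * y) ^ N * qpoch q (q * y) N - y ^ N * qpoch q y N"
    by simp
  from dvd_add[OF this Suc[folded y_def]]
  show ?case by (simp add: y_def mult.assoc)
qed

text \<open>Iterating the functional equation. Working modulo \<open>q\<^sup>N - 1\<close> keeps the truncation term
\<open>x\<^sup>N (xq;q)\<^sub>N\<close> the same in every step, so that it can be factored out.\<close>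

lemma zagier_sum_iterate_dvd:
  fixes q x :: "'a::comm_ring_1"
  shows "q ^ N - 1 dvd zagier_sum N q x - (- 1) ^ n * q ^ pentagonal n * x ^ (3 * n) * zagier_sum N q (q ^ n * x)
      - (1 - x ^ N * qpoch q x N) * pentagonal_sum n q x"
proof (induction n)
  case 0
  show ?case by (simp add: pentagonal_sum_def)
next
  case (Suc n)
  define d where "d = q ^ N - 1"
  define y where "y = q ^ n * x"
  define W where "W = x ^ N * qpoch q x N"
  define V where "V = y ^ N * qpoch q y N"
  define c where "c = (- 1) ^ n * q ^ pentagonal n * x ^ (3 * n)"
  define Z where "Z = zagier_sum N q y"
  define Z' where "Z' = zagier_sum N q (q * y)"
  have V: "d dvd V - W"
    unfolding d_def V_def W_def y_def by (rule tail_invariant_dvd)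
  have fe: "Z + q ^ 2 * y ^ 3 * Z' = (1 - q * y ^ 2) - V * (1 - q ^ (N + 1) * y ^ 2)"
    unfolding Z_def Z'_def V_def by (rule zagier_sum_functional_equation)
  have "Z + q ^ 2 * y ^ 3 * Z' - (1 - W) * (1 - q * y ^ 2)
      = d * (V * q * y ^ 2) - (V - W) * (1 - q * y ^ 2)"
    unfolding fe d_def by (simp add: algebra_simps)
  then have one: "d dvd Z + q ^ 2 * y ^ 3 * Z' - (1 - W) * (1 - q * y ^ 2)"
    using V by simp
  have c': "(- 1) ^ Suc n * q ^ pentagonal (Suc n) * x ^ (3 * Suc n) = - c * q ^ 2 * y ^ 3"
    unfolding c_def y_def pentagonal_Suc
    by (simp add: power_add power_mult power_mult_distrib power2_eq_square power3_eq_cube algebra_simps)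
  have th: "pentagonal_sum (Suc n) q x = pentagonal_sum n q x + c * (1 - q * y ^ 2)"
    unfolding pentagonal_sum_def c_def y_def
    by (simp add: power_add power_mult power_mult_distrib power2_eq_square algebra_simps)
  have y': "q ^ Suc n * x = q * y" by (simp add: y_def mult.assoc)
  have IH: "d dvd zagier_sum N q x - c * Z - (1 - W) * pentagonal_sum n q x"
    using Suc.IH unfolding d_def c_def Z_def W_def y_def .
  have "zagier_sum N q x - (- c * q ^ 2 * y ^ 3) * Z' - (1 - W) * (pentagonal_sum n q x + c * (1 - q * y ^ 2))
    = (zagier_sum N q x - c * Z - (1 - W) * pentagonal_sum n q x)
      + c * (Z + q ^ 2 * y ^ 3 * Z' - (1 - W) * (1 - q * y ^ 2))"
    by (simp add: algebra_simps)
  also have "d dvd \<dots>"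
    by (intro dvd_add IH dvd_mult one)
  finally show ?case
    unfolding c' th y' d_def Z'_def W_def .
qed

text \<open>After \<open>N\<close> iterations the argument has returned to \<open>x\<close>. Oddness of \<open>N\<close> is used twice: the sign
\<open>(-1)\<^sup>N\<close> becomes \<open>-1\<close>, so that the factor on the left does not vanish at \<open>x = 1\<close>, and \<open>N\<close>
divides its own pentagonal number \<open>N (3N + 1) / 2\<close>.\<close>

lemma zagier_identity_dvd:
  fixes q x :: "'a::comm_ring_1"
  assumes "odd N"
  shows "q ^ N - 1 dvd (1 + x ^ (3 * N)) * zagier_sum N q x - (1 - x ^ N * qpoch q x N) * pentagonal_sum N q x"
proof -
  define d where "d = q ^ N - 1"
  define R where "R = (1 - x ^ N * qpoch q x N) * pentagonal_sum N q x"
  obtain m where "3 * N + 1 = 2 * m"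
    using assms by (metis even_add even_mult_iff evenE odd_one odd_numeral)
  then have "pentagonal N = N * m" by (simp add: pentagonal_def)
  then have "q ^ pentagonal N = (q ^ N) ^ m" by (simp add: power_mult)
  also have "\<dots> - 1 = d * (\<Sum>i<m. (q ^ N) ^ i)"
    unfolding d_def by (rule power_diff_1_eq)
  finally have a: "d dvd q ^ pentagonal N - 1" by simp
  have "d dvd q ^ N * x - x"
    unfolding d_def by (rule dvdI[of _ _ x]) (simp add: algebra_simps)
  then have b: "d dvd zagier_sum N q (q ^ N * x) - zagier_sum N q x"
    by (rule zagier_sum_cong_dvd)
  have c: "d dvd zagier_sum N q x + q ^ pentagonal N * x ^ (3 * N) * zagier_sum N q (q ^ N * x) - R"
    using zagier_sum_iterate_dvd[of q N x N] assms by (simp add: d_def R_def)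
  have "(1 + x ^ (3 * N)) * zagier_sum N q x - R
     = (zagier_sum N q x + q ^ pentagonal N * x ^ (3 * N) * zagier_sum N q (q ^ N * x) - R)
      - q ^ pentagonal N * x ^ (3 * N) * (zagier_sum N q (q ^ N * x) - zagier_sum N q x)
      - (q ^ pentagonal N - 1) * (x ^ (3 * N) * zagier_sum N q x)"
    by (simp add: algebra_simps)
  also have "d dvd \<dots>"
    by (intro dvd_diff c dvd_mult b dvd_mult2 a)
  finally show ?thesis
    unfolding d_def R_def .
qed

section \<open>The strange identity modulo \<open>q\<^sup>N - 1\<close>\<close>

lemma poly_qpoch: "poly (qpoch [:q:] y n) a = qpoch q (poly y a) n"
  by (simp add: qpoch_def poly_prod)

lemma pentagonal_sum_poly:
  fixes q :: "'a::idom"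
  shows "pentagonal_sum n [:q:] [:0, 1:]
    = (\<Sum>j<n. monom ((- 1) ^ j * q ^ pentagonal j) (3 * j)
              - monom ((- 1) ^ j * q ^ pentagonal j * q ^ (2 * j + 1)) (3 * j + 2))"
proof -
  have const: "[:c:] ^ m = [:c ^ m:]" for c :: 'a and m
    by (induction m) simp_all
  have m1: "(- 1) ^ j = [:(- 1) ^ j :: 'a:]" for j
    using const[of "- 1" j] by (simp add: one_pCons)
  have "(- 1) ^ j * [:q:] ^ pentagonal j * [:0, 1:] ^ (3 * j) * (1 - [:q:] ^ (2 * j + 1) * [:0, 1:] ^ 2)
    = monom ((- 1) ^ j * q ^ pentagonal j) (3 * j)
       - monom ((- 1) ^ j * q ^ pentagonal j * q ^ (2 * j + 1)) (3 * j + 2)" for j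
    unfolding const m1
    by (simp add: monom_altdef power_add power2_eq_square algebra_simps smult_diff_right)
  then show ?thesis unfolding pentagonal_sum_def by simp
qed

text \<open>A finite form of Zagier's strange identity
\<open>F(q) = - 1/2 \<Sum> m (12/m) q\<^bsup>(m\<^sup>2 - 1)/24\<^esup>\<close>, whose right-hand side runs over
\<open>m = 6j + 1\<close> and \<open>m = 6j + 5\<close>. It is the first-order part at \<open>x = 1\<close> of the preceding
congruence, read in the polynomial ring in \<open>x\<close>. Value and derivative both count: the value shows
that the pentagonal sum \<open>T\<close> satisfies \<open>T(1) = 0\<close> modulo \<open>q\<^sup>N - 1\<close>, the derivative gives
\<open>2 F\<^sub>N = - T'(1)\<close>, and adding the two in the form \<open>4 F\<^sub>N = - (2 T'(1) + T(1))\<close> turns the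
coefficients \<open>(m - 1) / 2\<close> into \<open>m\<close>.\<close>

lemma strange_identity_dvd:
  fixes q :: "'a::idom"
  assumes "odd N"
  shows "q ^ N - 1 dvd 4 * (\<Sum>r<N. \<Prod>i=1..r. (1 - q ^ i))
     + (\<Sum>j<N. (- 1) ^ j * (of_nat (6 * j + 1) * q ^ pentagonal j
                   - of_nat (6 * j + 5) * q ^ (pentagonal j + 2 * j + 1)))"
proof -
  define d where "d = q ^ N - 1"
  define x :: "'a poly" where "x = [:0, 1:]"
  define T where "T = pentagonal_sum N [:q:] x"
  define S where "S = (\<Sum>r<N. qpoch [:q:] x r * x ^ r)"
  define W where "W = x ^ N * qpoch [:q:] x N"
  have x1 [simp]: "poly x 1 = 1" "poly (pderiv x) 1 = 1"
    by (simp_all add: x_def pderiv_pCons)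
  have "[:q:] ^ N = [:q ^ N:]" by (induction N) simp_all
  then have const: "[:q:] ^ N - 1 = [:d:]"
    by (simp add: d_def one_pCons)
  have "[:d:] dvd (1 + x ^ (3 * N)) * zagier_sum N [:q:] x - (1 - W) * T"
    using zagier_identity_dvd[OF assms, of "[:q:]" x] by (simp add: W_def T_def const)
  then obtain g where g: "(1 + x ^ (3 * N)) * ((1 - x) * S) - (1 - W) * T = [:d:] * g"
    by (auto simp: zagier_sum_def S_def elim: dvdE)
  \<comment> \<open>The truncation term vanishes at \<open>x = 1\<close> because \<open>(q;q)\<^sub>N\<close> contains the factor \<open>1 - q\<^sup>N\<close>.\<close>
  have W1: "d dvd poly W 1"
  proof -
    have "N \<ge> 1" using assms by (cases N) auto
    then have "qpoch q 1 N = (1 - q ^ N) * (\<Prod>i\<in>{1..N} - {N}. (1 - 1 * q ^ i))"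
      unfolding qpoch_def by (subst prod.remove[of _ N]) auto
    also have "\<dots> = d * (- (\<Prod>i\<in>{1..N} - {N}. (1 - 1 * q ^ i)))"
      by (simp add: d_def algebra_simps)
    finally show ?thesis by (simp add: W_def poly_qpoch)
  qed
  have T_val: "poly T 1 = (\<Sum>j<N. (- 1) ^ j * (q ^ pentagonal j - q ^ (pentagonal j + 2 * j + 1)))"
    unfolding T_def x_def pentagonal_sum_poly
    by (simp add: poly_sum poly_monom algebra_simps power_add)
  have T_der: "poly (pderiv T) 1 = (\<Sum>j<N. (- 1) ^ j * (of_nat (3 * j) * q ^ pentagonal j
      - of_nat (3 * j + 2) * q ^ (pentagonal j + 2 * j + 1)))"
    unfolding T_def x_def pentagonal_sum_poly
    by (simp add: poly_sum poly_monom higher_pderiv_sum[of 1, simplified] pderiv_diff pderiv_monom algebra_simps power_add)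
  have S_val: "poly S 1 = (\<Sum>r<N. \<Prod>i=1..r. (1 - q ^ i))"
    by (simp add: S_def poly_sum poly_qpoch) (simp add: qpoch_def)
  \<comment> \<open>The value at 1 of the congruence, and below that of its derivative.\<close>
  have "- ((1 - poly W 1) * poly T 1) = d * poly g 1"
    using arg_cong[OF g, of "\<lambda>f. poly f 1"] by simp
  then have "poly T 1 = poly W 1 * poly T 1 - d * poly g 1"
    by (simp add: algebra_simps)
  moreover have "d dvd \<dots>"
    using W1 by simp
  ultimately have T1: "d dvd poly T 1"
    by simp
  have "- 2 * poly S 1 + poly (pderiv W) 1 * poly T 1 - (1 - poly W 1) * poly (pderiv T) 1
      = d * poly (pderiv g) 1"
    using arg_cong[OF g, of "\<lambda>f. poly (pderiv f) 1"]
    by (simp add: pderiv_mult pderiv_diff pderiv_add pderiv_smult algebra_simps)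
  then have "4 * poly S 1 + (2 * poly (pderiv T) 1 + poly T 1)
      = poly T 1 * (1 + 2 * poly (pderiv W) 1) + poly W 1 * (2 * poly (pderiv T) 1)
        - d * (2 * poly (pderiv g) 1)"
    by algebra
  moreover have "d dvd \<dots>"
    by (intro dvd_diff dvd_add dvd_mult2 T1 W1) simp
  moreover have "2 * poly (pderiv T) 1 + poly T 1
    = (\<Sum>j<N. (- 1) ^ j * (of_nat (6 * j + 1) * q ^ pentagonal j
                   - of_nat (6 * j + 5) * q ^ (pentagonal j + 2 * j + 1)))"
    unfolding T_val T_der sum_distrib_left sum.distrib[symmetric]
    by (intro sum.cong refl) (simp add: algebra_simps)
  ultimately show ?thesis
    unfolding S_val d_def by simp
qed

section \<open>Powers of \<open>1 / (1 - X)\<close> modulo 5\<close>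

text \<open>The relations asserted in the theorem, as a condition on a single power series that is preserved
by linear combinations over the integers.\<close>

definition rel5 :: "int fps \<Rightarrow> bool" where
  "rel5 f \<longleftrightarrow> (\<forall>n. 5 dvd fps_nth f (5 * n + 3) - 3 * fps_nth f (5 * n + 2) \<and>
                   5 dvd 3 * fps_nth f (5 * n + 2) - 2 * fps_nth f (5 * n + 1))"

lemma rel5_0: "rel5 0"
  by (simp add: rel5_def)

lemma rel5_add: "rel5 f \<Longrightarrow> rel5 g \<Longrightarrow> rel5 (f + g)"
proof -
  assume "rel5 f" "rel5 g"
  then show ?thesis
    unfolding rel5_def fps_add_nth by (smt (verit) dvd_add)
qed

lemma rel5_mult_const: "rel5 f \<Longrightarrow> rel5 (fps_const c * f)"
proof -
  have *: "c * a - 3 * (c * b) = c * (a - 3 * b)" "3 * (c * a) - 2 * (c * b) = c * (3 * a - 2 * b)"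
    for a b :: int by (simp_all add: algebra_simps)
  show "rel5 f \<Longrightarrow> ?thesis"
    unfolding rel5_def by (simp add: *)
qed

lemma rel5_mult_5: "5 dvd c \<Longrightarrow> rel5 (fps_const c * f)"
  unfolding rel5_def by (auto elim!: dvdE simp: mult.assoc intro!: dvd_diff)

lemma rel5_sum: "(\<And>i. i \<in> A \<Longrightarrow> rel5 (f i)) \<Longrightarrow> rel5 (\<Sum>i\<in>A. f i)"
  by (induction A rule: infinite_finite_induct) (auto intro: rel5_0 rel5_add)

text \<open>Modulo 5, \<open>(1 - X)\<^sup>5 = 1 - X\<^sup>5\<close>, so \<open>g = f / (1 - X)\<^sup>5\<close> satisfies
\<open>g\<^sub>m = f\<^sub>m + g\<^bsub>m-5\<^esub>\<close>; the relations, which couple only coefficients in one block of five,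
follow by induction on the block.\<close>

lemma rel5_mult_u5:
  assumes "rel5 f"
  shows "rel5 (inv_1_minus_q ^ 5 * f)"
proof -
  define u where "u = inv_1_minus_q"
  define g where "g = u ^ 5 * f"
  define h where "h = (fps_X - 2 * fps_X ^ 2 + 2 * fps_X ^ 3 - fps_X ^ 4) * g"
  have "(1 - fps_X) ^ 5 * g = (u * (1 - fps_X)) ^ 5 * f"
    unfolding g_def power_mult_distrib by (simp only: ac_simps)
  also have "u * (1 - fps_X) = 1" unfolding u_def by (rule inv_1_minus_q)
  finally have "(1 - fps_X) ^ 5 * g = f" by simp
  moreover have "(1 - fps_X :: int fps) ^ 5
      = 1 - fps_X ^ 5 - 5 * (fps_X - 2 * fps_X ^ 2 + 2 * fps_X ^ 3 - fps_X ^ 4)"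
    by (simp add: algebra_simps eval_nat_numeral)
  ultimately have rec: "g = f + fps_X ^ 5 * g + fps_const 5 * h"
    unfolding h_def by (simp add: algebra_simps numeral_fps_const)
  define s where "s m = (if m < 5 then 0 else fps_nth g (m - 5))" for m
  have nth: "fps_nth g m = fps_nth f m + s m + 5 * fps_nth h m" for m
    using arg_cong[OF rec, of "\<lambda>f. fps_nth f m"] by (simp add: fps_X_power_mult_nth s_def)
  have lift: "5 dvd a * fps_nth g m - b * fps_nth g m'"
    if "5 dvd a * fps_nth f m - b * fps_nth f m'" "5 dvd a * s m - b * s m'" for a b m m'
  proof -
    have "a * fps_nth g m - b * fps_nth g m'
        = (a * fps_nth f m - b * fps_nth f m') + (a * s m - b * s m')
          + 5 * (a * fps_nth h m - b * fps_nth h m')"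
      unfolding nth by (simp add: algebra_simps)
    then show ?thesis using that by simp
  qed
  have f: "5 dvd 1 * fps_nth f (5 * n + 3) - 3 * fps_nth f (5 * n + 2)"
    "5 dvd 3 * fps_nth f (5 * n + 2) - 2 * fps_nth f (5 * n + 1)" for n
    using assms unfolding rel5_def by simp_all
  have "5 dvd 1 * fps_nth g (5 * n + 3) - 3 * fps_nth g (5 * n + 2) \<and>
        5 dvd 3 * fps_nth g (5 * n + 2) - 2 * fps_nth g (5 * n + 1)" for n
  proof (induction n)
    case 0
    show ?case by (intro conjI lift f) (simp_all add: s_def)
  next
    case (Suc n)
    have s: "s (5 * Suc n + k) = fps_nth g (5 * n + k)" for k
      by (simp add: s_def)
    show ?case using Suc by (intro conjI lift f) (simp_all only: s)
  qed
  then show ?thesis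
    unfolding rel5_def g_def u_def by simp
qed

lemma u_power_nth_Suc:
  "fps_nth (inv_1_minus_q ^ Suc k) (Suc n)
    = fps_nth (inv_1_minus_q ^ k) (Suc n) + fps_nth (inv_1_minus_q ^ Suc k) n"
proof -
  have "inv_1_minus_q ^ Suc k = inv_1_minus_q ^ k * (inv_1_minus_q * (1 - fps_X))
      + fps_X * inv_1_minus_q ^ Suc k"
    by (simp add: algebra_simps)
  then have "inv_1_minus_q ^ Suc k = inv_1_minus_q ^ k + fps_X * inv_1_minus_q ^ Suc k"
    by (simp only: inv_1_minus_q mult_1_right)
  then have "fps_nth (inv_1_minus_q ^ Suc k) (Suc n)
      = fps_nth (inv_1_minus_q ^ k + fps_X * inv_1_minus_q ^ Suc k) (Suc n)"
    by (rule arg_cong)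
  then show ?thesis by (simp add: fps_X_mult_nth)
qed

text \<open>By \<open>rel5_mult_u5\<close> only the exponents 0 and 2 have to be inspected. The square of
\<open>1 / (1 - X)\<close> has the coefficients \<open>n + 1\<close>, hence \<open>2, 3, 4\<close> modulo 5 at the positions in
question, and \<open>4 = 3 * 3 = 2 * 2\<close> modulo 5.\<close>

lemma rel5_u_power:
  assumes "e mod 5 = 0 \<or> e mod 5 = 2"
  shows "rel5 (inv_1_minus_q ^ e)"
proof -
  have u1: "fps_nth inv_1_minus_q n = 1" for n
  proof (induction n)
    case (Suc n)
    then show ?case using u_power_nth_Suc[of 0 n] by simp
  qed (simp add: inv_1_minus_q_nth_0)
  have u2: "fps_nth (inv_1_minus_q ^ 2) n = int n + 1" for n
  proof (induction n)
    case 0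
    show ?case by (simp add: fps_power_zeroth inv_1_minus_q_nth_0)
  next
    case (Suc n)
    then show ?case using u_power_nth_Suc[of 1 n] by (simp add: numeral_2_eq_2 u1)
  qed
  have "rel5 (inv_1_minus_q ^ (5 * a + r))" if "rel5 (inv_1_minus_q ^ r)" for a r
  proof (induction a)
    case (Suc a)
    have "inv_1_minus_q ^ (5 * Suc a + r) = inv_1_minus_q ^ 5 * inv_1_minus_q ^ (5 * a + r)"
      by (simp add: power_add[symmetric] ac_simps del: power_Suc)
    then show ?case using rel5_mult_u5[OF Suc] by simp
  qed (use that in simp)
  moreover have "rel5 (inv_1_minus_q ^ 0)"
    by (simp add: rel5_def)
  moreover have "rel5 (inv_1_minus_q ^ 2)"
    unfolding rel5_def u2 by (simp add: algebra_simps)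
  ultimately show ?thesis
    using assms by (metis mult_div_mod_eq)
qed

text \<open>The exponent \<open>(m\<^sup>2 - 1) / 24\<close> is congruent to \<open>1 - m\<^sup>2\<close> modulo 5, so it is 0 or 2 unless \<open>5\<close>
divides \<open>m\<close>. In the latter case the exponent is 1, for which the relations fail, but there the
coefficient \<open>m\<close> removes the term.\<close>

lemma rel5_pentagonal_term:
  assumes "24 * e + 1 = m ^ 2"
  shows "rel5 (fps_const (c * int m) * inv_1_minus_q ^ e)"
proof (cases "5 dvd m")
  case True
  then have "int 5 dvd int m" by (simp only: int_dvd_int_iff)
  then show ?thesis by (intro rel5_mult_5 dvd_mult) simp
next
  case False
  have "(24 * e + 1) mod 5 = (m mod 5) ^ 2 mod 5"
    by (simp only: assms power_mod)
  moreover have "m mod 5 \<in> {1, 2, 3, 4}" using False by simp presburger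
  ultimately have "(24 * e + 1) mod 5 = 1 \<or> (24 * e + 1) mod 5 = 4"
    by auto
  moreover have "(24 * e + 1) mod 5 = (24 * (e mod 5) + 1) mod 5"
    by (metis mod_add_left_eq mod_mult_right_eq)
  moreover have "e mod 5 \<in> {0, 1, 2, 3, 4}"
    by simp presburger
  ultimately have "e mod 5 = 0 \<or> e mod 5 = 2"
    by auto
  then show ?thesis by (intro rel5_mult_const rel5_u_power)
qed

lemma low_nth_dvd_mult:
  fixes f g :: "'a::comm_semiring_1 fps"
  assumes "\<And>n. n < M \<Longrightarrow> p dvd fps_nth f n" "m < M"
  shows "p dvd fps_nth (f * g) m"
  unfolding fps_mult_nth using assms by (intro dvd_sum dvd_mult2) auto

text \<open>By Frobenius, \<open>(1 - X)\<^sup>N = 1 - X\<^sup>N\<close> modulo 5 for \<open>N = 5\<^sup>k\<close>, which is 1 up to order \<open>N\<close>; hence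
so is its inverse. This is the sense in which \<open>1 / (1 - X)\<close> behaves like an \<open>N\<close>-th root of unity.\<close>

lemma u_power_prime_power_dvd:
  assumes "n < 5 ^ k"
  shows "5 dvd fps_nth (inv_1_minus_q ^ (5 ^ k) - 1) n"
proof -
  define N :: nat where "N = 5 ^ k"
  define y :: "int fps" where "y = (1 - fps_X) ^ N"
  have binom: "5 dvd N choose m" if "0 < m" "m < N" for m
  proof (rule ccontr)
    assume "\<not> 5 dvd N choose m"
    then have "coprime (5 :: nat) (N choose m)"
      by (intro prime_imp_coprime) simp_all
    then have "coprime N (N choose m)"
      unfolding N_def by simp
    moreover have "N dvd m * (N choose m)"
      using that by (simp add: times_binomial_minus1_eq)
    ultimately have "N dvd m" by (simp add: coprime_dvd_mult_left_iff)
    then show False using that by (simp add: nat_dvd_not_less)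
  qed
  have "y = (- fps_X + 1) ^ N" by (simp add: y_def)
  also have "\<dots> = (\<Sum>i\<le>N. of_nat (N choose i) * (- fps_X) ^ i)"
    by (subst binomial_ring) simp
  also have "\<dots> = (\<Sum>i\<le>N. fps_const (int (N choose i) * (- 1) ^ i) * fps_X ^ i)"
    by (intro sum.cong refl, subst power_minus)
       (simp add: fps_of_nat[symmetric] fps_const_power[symmetric] fps_const_neg[symmetric]
          fps_const_mult[symmetric] del: fps_const_power fps_const_neg fps_const_mult)
  finally have y: "y = (\<Sum>i\<le>N. fps_const (int (N choose i) * (- 1) ^ i) * fps_X ^ i)" .
  have y_nth: "fps_nth y m = int (N choose m) * (- 1) ^ m" if "m \<le> N" for m
    unfolding y using that
    by (simp add: fps_sum_nth if_distrib[of "\<lambda>t. _ * t"] cong: if_cong)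
  have low: "5 dvd fps_nth (1 - y) m" if "m < N" for m
  proof (cases "m = 0")
    case False
    then have "int 5 dvd int (N choose m)" using binom that by (simp only: int_dvd_int_iff)
    with False that show ?thesis by (simp add: y_nth)
  qed (simp add: y_nth)
  have "inv_1_minus_q ^ N * y = 1"
    unfolding y_def power_mult_distrib[symmetric] inv_1_minus_q by simp
  then have "inv_1_minus_q ^ N - 1 = (1 - y) * inv_1_minus_q ^ N"
    by (simp add: algebra_simps)
  then show ?thesis
    using low_nth_dvd_mult[of N 5 "1 - y" n] low assms by (simp add: N_def)
qed

section \<open>The congruences\<close>

lemma xi_minus_1_eq_partial_sum:
  assumes "m < M"
  shows "xi_minus_1 m = fps_nth (\<Sum>r<M. \<Prod>i=1..r. (1 - inv_1_minus_q ^ i)) m"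
proof -
  let ?t = "\<lambda>n. \<Prod>i=1..n. (1 - inv_1_minus_q ^ i)"
  have "(\<lambda>n. \<Sum>r<n. ?t r) \<longlonglongrightarrow> kontsevich_F inv_1_minus_q"
    using kontsevich_F_sums[OF inv_1_minus_q_nth_0] by (simp add: sums_def)
  then have "\<forall>\<^sub>F n in sequentially. fps_nth (\<Sum>r<n. ?t r) m = xi_minus_1 m"
    unfolding xi_minus_1_def by (simp only: tendsto_fps_iff)
  then obtain L where L: "\<And>n. n \<ge> L \<Longrightarrow> fps_nth (\<Sum>r<n. ?t r) m = xi_minus_1 m"
    by (auto simp: eventually_sequentially)
  have "fps_nth (\<Sum>r<M. ?t r) m = fps_nth (\<Sum>r<max L M. ?t r) m"
    unfolding fps_sum_nth
    using summand_nth_eq_0[OF inv_1_minus_q_nth_0] assms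
    by (intro sum.mono_neutral_left) (auto simp del: fps_prod_nth)
  then show ?thesis using L[of "max L M"] by simp
qed

theorem mainTheorem7:
  fixes n :: nat
  shows "[xi_minus_1 (5 * n + 3) = 3 * xi_minus_1 (5 * n + 2)] (mod 5) \<and>
         [3 * xi_minus_1 (5 * n + 2) = 2 * xi_minus_1 (5 * n + 1)] (mod 5)"
proof -
  define k where "k = 5 * n + 4"
  define N :: nat where "N = 5 ^ k"
  define u where "u = inv_1_minus_q"
  define P where "P = (\<Sum>r<N. \<Prod>i=1..r. (1 - u ^ i))"
  define R where "R = (\<Sum>j<N. (- 1) ^ j * (of_nat (6 * j + 1) * u ^ pentagonal j
                   - of_nat (6 * j + 5) * u ^ (pentagonal j + 2 * j + 1)))"
  have small: "m < N" if "m < k" for m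
    using that less_exp[of k] power_mono[of "2::nat" 5 k] unfolding N_def by linarith
  \<comment> \<open>Any power of 5 exceeding the indices in question would do: it is odd, and \<open>u\<^sup>N\<close> is 1 modulo 5 up to order \<open>N\<close>.\<close>
  have "odd N" by (simp add: N_def)
  from strange_identity_dvd[OF this, of u]
  obtain g where g: "4 * P + R = (u ^ N - 1) * g"
    unfolding P_def R_def by (elim dvdE)
  have "5 dvd fps_nth (4 * P + R) m" if "m < N" for m
    unfolding g using that u_power_prime_power_dvd[of _ k]
    by (intro low_nth_dvd_mult[of N]) (auto simp: N_def u_def)
  moreover have "fps_nth (4 * P + R) m = 4 * xi_minus_1 m + fps_nth R m" if "m < N" for m
    using xi_minus_1_eq_partial_sum[OF that]
    by (simp add: P_def u_def numeral_fps_const)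
  ultimately have xi: "5 dvd 4 * xi_minus_1 m + fps_nth R m" if "m < k" for m
    using small[OF that] by simp
  have "rel5 R"
  proof -
    have sign: "(- 1 :: int fps) ^ j = fps_const ((- 1) ^ j)" for j
      by (induction j) (simp_all flip: fps_const_neg)
    have two_pentagonal: "2 * pentagonal j = j * (3 * j + 1)" for j
      by (induction j) (simp_all add: pentagonal_Suc algebra_simps)
    have "(- 1) ^ j * (of_nat (6 * j + 1) * u ^ pentagonal j
                   - of_nat (6 * j + 5) * u ^ (pentagonal j + 2 * j + 1))
       = fps_const ((- 1) ^ j * int (6 * j + 1)) * u ^ pentagonal j
         + fps_const ((- 1) ^ Suc j * int (6 * j + 5)) * u ^ (pentagonal j + 2 * j + 1)" for j
      unfolding sign fps_of_nat[symmetric] 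
      by (simp only: fps_const_mult[symmetric] power_Suc) (simp add: algebra_simps flip: fps_const_neg)
    moreover have "24 * pentagonal j + 1 = (6 * j + 1) ^ 2"
      "24 * (pentagonal j + 2 * j + 1) + 1 = (6 * j + 5) ^ 2" for j
      using two_pentagonal[of j] by (simp_all add: power2_eq_square algebra_simps)
    ultimately show ?thesis
      unfolding R_def u_def by (intro rel5_sum) (simp only: rel5_add rel5_pentagonal_term)
  qed
  then have R: "5 dvd fps_nth R (5 * n + 3) - 3 * fps_nth R (5 * n + 2)"
    "5 dvd 3 * fps_nth R (5 * n + 2) - 2 * fps_nth R (5 * n + 1)"
    unfolding rel5_def by blast+
  \<comment> \<open>Modulo 5 the factor 4 is \<open>-1\<close>.\<close>
  have xi_R: "5 dvd xi_minus_1 m - fps_nth R m" if "m < k" for m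
  proof -
    have "xi_minus_1 m - fps_nth R m = 5 * xi_minus_1 m - (4 * xi_minus_1 m + fps_nth R m)"
      by simp
    then show ?thesis using xi[OF that] by (simp only: dvd_diff dvd_triv_left)
  qed
  have transfer: "5 dvd a * xi_minus_1 m - b * xi_minus_1 m'"
    if "5 dvd a * fps_nth R m - b * fps_nth R m'" "m < k" "m' < k" for a b m m'
  proof -
    have "a * xi_minus_1 m - b * xi_minus_1 m'
        = (a * fps_nth R m - b * fps_nth R m')
          + a * (xi_minus_1 m - fps_nth R m) - b * (xi_minus_1 m' - fps_nth R m')"
      by (simp add: algebra_simps)
    then show ?thesis
      using that xi_R by (simp only: dvd_diff dvd_add dvd_mult)
  qed
  show ?thesis
    unfolding cong_iff_dvd_diff
    using transfer[of 1 "5 * n + 3" 3 "5 * n + 2"] transfer[of 3 "5 * n + 2" 2 "5 * n + 1"] R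
    by (simp add: k_def)
qed

end
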